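(* Let $q$ be an odd prime and $H\in\operatorname{BH}(n,q)$. Then the covering radius of the Butson Hadamard code $C_H$ satisfies \[ r(C_H)\le \frac{q-1}{q}\,n-\frac1q\sqrt n. \]
   Context: $\operatorname{BH}(n,q)$ is the set of $n\times n$ matrices $H$ with entries in the $q$-th roots of unity and $HH^*=nI_n$. The logarithmic form $L(H)$ of $H=[\zeta_q^{\varphi_{i,j}}]$ (with $\zeta_q=e^{2\pi\sqrt{-1}/q}$) is the matrix $[\varphi_{i,j}\bmod q]$ over $\mathbb{Z}_q$. $R_H\subseteq\mathbb{Z}_q^n$ is the set of rows of $L(H)$, and $C_H=\bigcup_{\alpha\in\mathbb{Z}_q}(R_H+\alpha\mathbf{1})$, where $\mathbf{1}$ is the all-ones vector. The Hamming distance $d(\mathbf v,\mathbf w)$ is the number of coordinates where $\mathbf v,\mathbf w$ differ, and the covering radius of $C\subseteq\mathbb{Z}_q^n$ is $r(C)=\max_{\mathbf x\in\mathbb{Z}_q^n}\min_{\mathbf y\in C}d(\mathbf x,\mathbf y)$. *)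

theory Defs
  imports
    Complex_Main
    "HOL-Computational_Algebra.Primes"
    "Jordan_Normal_Form.Schur_Decomposition"
begin

definition butson_hadamard :: "nat \<Rightarrow> nat \<Rightarrow> complex mat set" where
  "butson_hadamard n q =
    {H \<in> carrier_mat n n.
      (\<forall>i<n. \<forall>j<n. (H $$ (i, j)) ^ q = 1) \<and>
      H * mat_adjoint H = of_nat n \<cdot>\<^sub>m 1\<^sub>m n}"

definition zeta :: "nat \<Rightarrow> complex" where
  "zeta q = exp (2 * of_real pi * \<i> / of_nat q)"

text \<open>
  The ring of integers modulo \<open>q\<close> is represented by the residues \<open>0, \<dots>, q - 1\<close> in
  \<^typ>\<open>nat\<close>, with addition taken modulo \<open>q\<close>.
\<close>

definition Zq_vecs :: "nat \<Rightarrow> nat \<Rightarrow> nat vec set" where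
  "Zq_vecs q n = {v \<in> carrier_vec n. \<forall>i<n. v $ i < q}"

text \<open>
  For \<open>q > 0\<close> the residue \<open>k\<close> below exists and is unique whenever the entry is a \<open>q\<close>-th root
  of unity.
\<close>

definition log_form :: "nat \<Rightarrow> complex mat \<Rightarrow> nat mat" where
  "log_form q H =
    mat (dim_row H) (dim_col H) (\<lambda>(i, j). THE k. k < q \<and> H $$ (i, j) = zeta q ^ k)"

definition log_rows :: "nat \<Rightarrow> complex mat \<Rightarrow> nat vec set" where
  "log_rows q H = set (rows (log_form q H))"

definition add_const :: "nat \<Rightarrow> nat \<Rightarrow> nat vec \<Rightarrow> nat vec" where
  "add_const q \<alpha> v = map_vec (\<lambda>a. (a + \<alpha>) mod q) v"

definition butson_code :: "nat \<Rightarrow> complex mat \<Rightarrow> nat vec set" where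
  "butson_code q H = (\<Union>\<alpha>\<in>{..<q}. add_const q \<alpha> ` log_rows q H)"

text \<open>Only meant for vectors of equal dimension.\<close>

definition hamming_dist :: "'a vec \<Rightarrow> 'a vec \<Rightarrow> nat" where
  "hamming_dist v w = card {i. i < dim_vec v \<and> v $ i \<noteq> w $ i}"

text \<open>
  Meant for \<open>q > 0\<close> and a nonempty code \<open>C\<close> contained in \<^term>\<open>Zq_vecs q n\<close>; the minimum and
  the maximum are then over finite nonempty sets.
\<close>

definition covering_radius :: "nat \<Rightarrow> nat \<Rightarrow> nat vec set \<Rightarrow> nat" where
  "covering_radius q n C = (MAX x\<in>Zq_vecs q n. MIN y\<in>C. hamming_dist x y)"

end

theory Submission
  imports Defs
begin

text \<open>
  Fix \<open>x \<in> \<int>\<^sub>q\<^sup>n\<close> and put \<open>S\<^sub>i = \<Sum>\<^sub>j \<zeta>^(x\<^sub>j - \<phi>\<^sub>i\<^sub>j)\<close>. By Parseval some \<open>\<bar>S\<^sub>i\<bar>\<close> is at least \<open>\<surd>n\<close>.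
  If \<open>N a\<close> counts the \<open>j\<close> with \<open>x\<^sub>j - \<phi>\<^sub>i\<^sub>j = a\<close> and \<open>M\<close> is the largest of these counts, then
  \<open>S\<^sub>i = \<Sum>\<^sub>a N a \<zeta>\<^sup>a = - \<Sum>\<^sub>a (M - N a) \<zeta>\<^sup>a\<close> because the \<open>q\<close>-th roots of unity sum to zero, so
  \<open>\<bar>S\<^sub>i\<bar> \<le> q M - n\<close>. The codeword obtained from row \<open>i\<close> by adding the constant that attains \<open>M\<close> is at
  distance \<open>n - M\<close> from \<open>x\<close>.
\<close>

lemma zeta_power: "zeta q ^ k = cis (2 * pi * real k / real q)"
proof -
  have "zeta q = cis (2 * pi / real q)"
    by (simp add: zeta_def cis_conv_exp mult_ac)
  then show ?thesis
    by (simp add: DeMoivre mult_ac)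
qed

lemma norm_zeta_power [simp]: "norm (zeta q ^ k) = 1"
  by (simp add: zeta_power)

lemma bij_betw_zeta_power:
  assumes "q > 0"
  shows "bij_betw (\<lambda>k. zeta q ^ k) {..<q} {z. z ^ q = 1}"
  using bij_betw_roots_unity[OF assms] by (simp add: zeta_power)

lemma sum_zeta_power:
  assumes "q > 1"
  shows "(\<Sum>k<q. zeta q ^ k) = 0"
  using sum_roots_unity[OF assms] sum.reindex_bij_betw[OF bij_betw_zeta_power[of q], of "\<lambda>z. z"] assms
  by simp

lemma zeta_power_q: "q > 0 \<Longrightarrow> zeta q ^ q = 1"
  by (simp add: zeta_power)

lemma zeta_power_mod:
  assumes "q > 0"
  shows "zeta q ^ (k mod q) = zeta q ^ k"
proof -
  have "zeta q ^ k = zeta q ^ (q * (k div q) + k mod q)"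
    by simp
  also have "\<dots> = zeta q ^ (k mod q)"
    unfolding power_add power_mult zeta_power_q[OF assms] by simp
  finally show ?thesis ..
qed

text \<open>Residues are natural numbers, so the exponent \<open>-l\<close> has to be represented by
  \<open>q - l\<close>. Both sides are inverse to \<open>zeta q ^ l\<close>, hence equal.\<close>

lemma cnj_zeta_power:
  assumes "l \<le> q" "q > 0"
  shows "cnj (zeta q ^ l) = zeta q ^ (q - l)"
proof -
  have "zeta q ^ (q - l) * zeta q ^ l = 1"
    using assms by (simp add: zeta_power_q flip: power_add)
  moreover have "cnj (zeta q ^ l) * zeta q ^ l = 1"
    by (simp only: zeta_power cis_cnj cis_mult) simp
  moreover have "zeta q ^ l \<noteq> 0"
    by (simp add: zeta_power)
  ultimately show ?thesis
    by (metis mult_right_cancel)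
qed

lemma dominant_residue_class:
  fixes c :: "'a \<Rightarrow> nat"
  assumes "q > 1" "finite J" and c: "c ` J \<subseteq> {..<q}"
  obtains a where "a < q"
    and "real (card J) + norm (\<Sum>j\<in>J. zeta q ^ c j) \<le> real q * real (card {j\<in>J. c j = a})"
proof -
  define N where "N a = card {j\<in>J. c j = a}" for a
  define M where "M = Max (N ` {..<q})"
  have le: "N a \<le> M" if "a < q" for a
    unfolding M_def using that by (intro Max_ge) auto
  have "M \<in> N ` {..<q}"
    unfolding M_def using assms(1) by (intro Max_in) (auto simp: lessThan_empty_iff)
  then obtain a where a: "a < q" "N a = M"
    by auto
  have total: "(\<Sum>a<q. N a) = card J"
    using sum.group[OF assms(2) finite_lessThan c, of "\<lambda>_. 1::nat"] by (simp add: N_def)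
  have "(\<Sum>j\<in>J. zeta q ^ c j) = (\<Sum>a<q. of_nat (N a) * zeta q ^ a)"
    unfolding N_def using assms(2) c by (intro sum_fun_comp) auto
  \<comment> \<open>Subtracting from the maximal count makes all coefficients nonnegative, so the
    triangle inequality gives their plain sum \<open>q * M - card J\<close>. The subtraction
    \<open>M - N a\<close> on naturals is exact by \<open>le\<close>.\<close>
  also have "\<dots> = of_nat M * (\<Sum>a<q. zeta q ^ a) - (\<Sum>a<q. of_nat (M - N a) * zeta q ^ a)"
    by (simp add: sum_distrib_left of_nat_diff le algebra_simps flip: sum_subtractf)
  also have "\<dots> = - (\<Sum>a<q. of_nat (M - N a) * zeta q ^ a)"
    using sum_zeta_power[OF assms(1)] by simp
  finally have "norm (\<Sum>j\<in>J. zeta q ^ c j) \<le> (\<Sum>a<q. norm (of_nat (M - N a) * zeta q ^ a))"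
    by (simp only: norm_minus_cancel norm_sum)
  also have "\<dots> = (\<Sum>a<q. real M - real (N a))"
    by (intro sum.cong refl) (simp only: norm_mult norm_zeta_power norm_of_nat, simp add: of_nat_diff le)
  also have "\<dots> = real q * real M - real (card J)"
    by (simp add: sum_subtractf flip: total)
  finally show thesis
    using that[OF a(1)] a(2) by (simp add: N_def)
qed

text \<open>The definition of \<open>butson_hadamard\<close> only gives orthogonal rows. For square
  matrices a right inverse is also a left inverse, so after scaling by \<open>1 / n\<close> the
  adjoint can be moved to the other side of \<open>H\<close>.\<close>

lemma butson_hadamard_columns_orthogonal:
  assumes H: "H \<in> butson_hadamard n q" and "n \<ge> 1" "j < n" "k < n"
  shows "(\<Sum>i<n. cnj (H $$ (i, j)) * H $$ (i, k)) = (if j = k then of_nat n else 0)"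
proof -
  have car: "H \<in> carrier_mat n n" "mat_adjoint H \<in> carrier_mat n n"
    using H by (auto simp: butson_hadamard_def mat_adjoint_def)
  have "H * ((1 / of_nat n) \<cdot>\<^sub>m mat_adjoint H) = (1 / of_nat n) \<cdot>\<^sub>m (H * mat_adjoint H)"
    using car by (rule mult_smult_distrib)
  also have "\<dots> = 1\<^sub>m n"
    using H assms(2) by (auto simp: butson_hadamard_def)
  finally have "((1 / of_nat n) \<cdot>\<^sub>m mat_adjoint H) * H = 1\<^sub>m n"
    by (rule mat_mult_left_right_inverse[OF car(1) smult_carrier_mat[OF car(2)]])
  then have "(((1 / of_nat n) \<cdot>\<^sub>m mat_adjoint H) * H) $$ (j, k) = (if j = k then 1 else 0)"
    using assms(3,4) by simp
  moreover have "(((1 / of_nat n) \<cdot>\<^sub>m mat_adjoint H) * H) $$ (j, k)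
      = (1 / of_nat n) * (\<Sum>i<n. cnj (H $$ (i, j)) * H $$ (i, k))"
    using car(1) assms(3,4)
    by (simp add: scalar_prod_def mat_adjoint_def mat_of_rows_def sum_distrib_left atLeast0LessThan mult_ac)
  ultimately show ?thesis
    using assms(2) by (simp add: field_simps split: if_splits)
qed

text \<open>Writing each square as a product with the conjugate and summing over the rows first
  leaves inner products of columns, and orthogonality keeps only the diagonal
  \<open>j = k\<close>.\<close>

lemma butson_hadamard_parseval:
  assumes "H \<in> butson_hadamard n q" and "n \<ge> 1"
  shows "(\<Sum>i<n. (norm (\<Sum>j<n. u j * cnj (H $$ (i, j))))\<^sup>2) = real n * (\<Sum>j<n. (norm (u j))\<^sup>2)"
proof -
  have "complex_of_real (\<Sum>i<n. (norm (\<Sum>j<n. u j * cnj (H $$ (i, j))))\<^sup>2)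
     = (\<Sum>i<n. (\<Sum>j<n. u j * cnj (H $$ (i, j))) * (\<Sum>k<n. cnj (u k) * H $$ (i, k)))"
    by (simp add: complex_norm_square del: of_real_power)
  also have "\<dots> = (\<Sum>i<n. \<Sum>j<n. \<Sum>k<n. u j * cnj (u k) * (cnj (H $$ (i, j)) * H $$ (i, k)))"
    by (simp add: sum_product mult_ac)
  also have "\<dots> = (\<Sum>j<n. \<Sum>i<n. \<Sum>k<n. u j * cnj (u k) * (cnj (H $$ (i, j)) * H $$ (i, k)))"
    by (rule sum.swap)
  also have "\<dots> = (\<Sum>j<n. \<Sum>k<n. \<Sum>i<n. u j * cnj (u k) * (cnj (H $$ (i, j)) * H $$ (i, k)))"
    by (intro sum.cong refl sum.swap)
  also have "\<dots> = (\<Sum>j<n. \<Sum>k<n. u j * cnj (u k) * (if j = k then of_nat n else 0))"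
    by (intro sum.cong refl)
      (simp add: butson_hadamard_columns_orthogonal[OF assms] flip: sum_distrib_left)
  also have "\<dots> = (\<Sum>j<n. u j * cnj (u j) * of_nat n)"
    by (intro sum.cong refl) (simp add: if_distrib cong: if_cong)
  also have "\<dots> = complex_of_real (real n * (\<Sum>j<n. (norm (u j))\<^sup>2))"
    by (simp add: complex_norm_square sum_distrib_left mult_ac del: of_real_power)
  finally show ?thesis
    by (simp only: of_real_eq_iff)
qed

text \<open>An averaging argument: for unimodular \<open>u\<close> the \<open>n\<close> squared
  correlations add up to \<open>n * n\<close>, so they cannot all be below \<open>n\<close>.\<close>

lemma butson_hadamard_large_correlation:
  assumes "H \<in> butson_hadamard n q" and "n \<ge> 1" and "\<And>j. j < n \<Longrightarrow> norm (u j) = 1"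
  shows "\<exists>i<n. sqrt (real n) \<le> norm (\<Sum>j<n. u j * cnj (H $$ (i, j)))"
proof (rule ccontr)
  assume "\<not> ?thesis"
  then have "norm (\<Sum>j<n. u j * cnj (H $$ (i, j))) < sqrt (real n)" if "i < n" for i
    using that by (simp add: not_le)
  then have "(norm (\<Sum>j<n. u j * cnj (H $$ (i, j))))\<^sup>2 < real n" if "i < n" for i
    using power_strict_mono[of _ "sqrt (real n)" 2] that by fastforce
  then have "(\<Sum>i<n. (norm (\<Sum>j<n. u j * cnj (H $$ (i, j))))\<^sup>2) < (\<Sum>i<n. real n)"
    using assms(2) by (intro sum_strict_mono) (auto simp: lessThan_empty_iff)
  then show False
    using assms(3) by (simp add: butson_hadamard_parseval[OF assms(1,2)])
qed

text \<open>The bijection between \<open>{..<q}\<close> and the \<open>q\<close>-th roots of unity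
  supplies the existence and uniqueness that the \<open>THE\<close> in \<open>log_form\<close>
  relies on.\<close>

lemma log_form_index:
  assumes "H \<in> butson_hadamard n q" "q > 0" "i < n" "j < n"
  shows "log_form q H $$ (i, j) < q" and "H $$ (i, j) = zeta q ^ (log_form q H $$ (i, j))"
proof -
  have "H \<in> carrier_mat n n" "H $$ (i, j) \<in> {z. z ^ q = 1}"
    using assms by (auto simp: butson_hadamard_def)
  then have the: "log_form q H $$ (i, j) = (THE k. k < q \<and> H $$ (i, j) = zeta q ^ k)"
    using assms(3,4) by (simp add: log_form_def)
  have "\<exists>!k. k \<in> {..<q} \<and> zeta q ^ k = H $$ (i, j)"
    using bij_betw_zeta_power[OF assms(2)] \<open>H $$ (i, j) \<in> _\<close> by (simp only: bij_betw_iff_bijections) metis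
  then have "\<exists>!k. k < q \<and> H $$ (i, j) = zeta q ^ k"
    by (simp only: lessThan_iff eq_commute[of "H $$ (i, j)"])
  from theI'[OF this] show "log_form q H $$ (i, j) < q" "H $$ (i, j) = zeta q ^ (log_form q H $$ (i, j))"
    unfolding the by blast+
qed

lemma finite_Zq_vecs: "finite (Zq_vecs q n)"
proof (rule finite_subset)
  show "Zq_vecs q n \<subseteq> vec n ` (\<Pi>\<^sub>E i\<in>{..<n}. {..<q})"
  proof
    fix v assume "v \<in> Zq_vecs q n"
    then have "v = vec n (restrict (\<lambda>i. v $ i) {..<n})" "restrict (\<lambda>i. v $ i) {..<n} \<in> (\<Pi>\<^sub>E i\<in>{..<n}. {..<q})"
      by (auto simp: Zq_vecs_def)
    then show "v \<in> vec n ` (\<Pi>\<^sub>E i\<in>{..<n}. {..<q})"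
      by blast
  qed
qed (simp add: finite_PiE)

lemma finite_butson_code: "finite (butson_code q H)"
  by (simp add: butson_code_def log_rows_def)

lemma covering_radius_le:
  assumes "q > 0" "finite C"
    and "\<And>x. x \<in> Zq_vecs q n \<Longrightarrow> \<exists>y\<in>C. real (hamming_dist x y) \<le> b"
  shows "real (covering_radius q n C) \<le> b"
proof -
  \<comment> \<open>The zero vector shows that the maximum is over a nonempty set and hence attained
    at some word.\<close>
  have "0\<^sub>v n \<in> Zq_vecs q n"
    using assms(1) by (simp add: Zq_vecs_def)
  then have "covering_radius q n C \<in> (\<lambda>x. MIN y\<in>C. hamming_dist x y) ` Zq_vecs q n"
    unfolding covering_radius_def by (intro Max_in) (auto simp: finite_Zq_vecs)
  then obtain x where x: "x \<in> Zq_vecs q n" "covering_radius q n C = (MIN y\<in>C. hamming_dist x y)"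
    by auto
  obtain y where "y \<in> C" "real (hamming_dist x y) \<le> b"
    using assms(3)[OF x(1)] by blast
  moreover from \<open>y \<in> C\<close> have "covering_radius q n C \<le> hamming_dist x y"
    unfolding x(2) using assms(2) by (intro Min_le) auto
  ultimately show ?thesis
    by linarith
qed

text \<open>Agreement of \<open>x\<close> with the shifted word at \<open>j\<close> means that
  \<open>x - v\<close> takes the value \<open>a\<close> there, modulo \<open>q\<close>; the two
  cardinalities count complementary sets of coordinates.\<close>

lemma hamming_dist_add_const:
  assumes "v \<in> carrier_vec n" "x \<in> Zq_vecs q n" "\<And>j. j < n \<Longrightarrow> v $ j < q" "a < q"
  shows "hamming_dist x (add_const q a v) + card {j\<in>{..<n}. (x $ j + (q - v $ j)) mod q = a} = n"
proof -
  have "(x $ j + (q - v $ j)) mod q = a \<longleftrightarrow> x $ j = (v $ j + a) mod q" if "j < n" for j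
  proof -
    have lt: "x $ j < q" "v $ j < q"
      using assms that by (auto simp: Zq_vecs_def)
    \<comment> \<open>Here and in the next reduction the argument is below \<open>2 * q\<close>, so
      \<open>mod\<close> subtracts \<open>q\<close> at most once and four linear cases
      remain.\<close>
    have "(x $ j + (q - v $ j)) mod q = (if x $ j < v $ j then x $ j + q - v $ j else x $ j - v $ j)"
      using lt by (simp add: le_mod_geq)
    moreover have "(v $ j + a) mod q = (if v $ j + a < q then v $ j + a else v $ j + a - q)"
      using lt assms(4) by (simp add: le_mod_geq)
    ultimately show ?thesis
      using lt assms(4) by (cases "x $ j < v $ j"; cases "v $ j + a < q") (simp only: if_True if_False, arith)+
  qed
  then have eq: "{j\<in>{..<n}. (x $ j + (q - v $ j)) mod q = a} = {..<n} - {j\<in>{..<n}. x $ j \<noteq> (v $ j + a) mod q}"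
    by auto
  have "hamming_dist x (add_const q a v) = card {j\<in>{..<n}. x $ j \<noteq> (v $ j + a) mod q}"
    using assms unfolding hamming_dist_def add_const_def Zq_vecs_def
    by (intro arg_cong[of _ _ card]) auto
  moreover have "card {j\<in>{..<n}. x $ j \<noteq> (v $ j + a) mod q} \<le> card {..<n}"
    by (intro card_mono) auto
  ultimately show ?thesis
    unfolding eq by (subst card_Diff_subset) auto
qed

lemma butson_code_close_word:
  assumes H: "H \<in> butson_hadamard n q" and "n \<ge> 1" "q > 1" and x: "x \<in> Zq_vecs q n"
  shows "\<exists>y\<in>butson_code q H.
    real (hamming_dist x y) \<le> (real q - 1) / real q * real n - 1 / real q * sqrt (real n)"
proof -
  have dim: "dim_row H = n" "dim_col H = n"
    using H by (auto simp: butson_hadamard_def)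
  \<comment> \<open>The word \<open>x\<close> is turned into the unimodular vector with entries
    \<open>zeta q ^ (x $ j)\<close>, to be correlated with the rows of \<open>H\<close>.\<close>
  have "\<exists>i<n. sqrt (real n) \<le> norm (\<Sum>j<n. zeta q ^ (x $ j) * cnj (H $$ (i, j)))"
    by (rule butson_hadamard_large_correlation[OF H assms(2)]) (rule norm_zeta_power)
  then obtain i where i: "i < n"
    and S: "sqrt (real n) \<le> norm (\<Sum>j<n. zeta q ^ (x $ j) * cnj (H $$ (i, j)))"
    by blast
  define v where "v = row (log_form q H) i"
  \<comment> \<open>\<open>c\<close> is the difference \<open>x - v\<close> in residues; its most
    frequent value \<open>a\<close> will be the constant added to row \<open>v\<close>.\<close>
  define c where "c j = (x $ j + (q - v $ j)) mod q" for j
  have v: "v $ j < q" "H $$ (i, j) = zeta q ^ (v $ j)" if "j < n" for j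
  proof -
    have "v $ j = log_form q H $$ (i, j)"
      using that i dim by (simp add: v_def log_form_def)
    then show "v $ j < q" "H $$ (i, j) = zeta q ^ (v $ j)"
      using log_form_index[OF H _ i that] assms(3) by auto
  qed
  have "(\<Sum>j<n. zeta q ^ (x $ j) * cnj (H $$ (i, j))) = (\<Sum>j<n. zeta q ^ c j)"
  proof (intro sum.cong refl)
    fix j assume "j \<in> {..<n}"
    then have "cnj (H $$ (i, j)) = zeta q ^ (q - v $ j)"
      using v[of j] assms(3) by (simp add: cnj_zeta_power del: complex_cnj_power)
    then show "zeta q ^ (x $ j) * cnj (H $$ (i, j)) = zeta q ^ c j"
      using assms(3) by (simp add: c_def zeta_power_mod power_add)
  qed
  with S have S': "sqrt (real n) \<le> norm (\<Sum>j<n. zeta q ^ c j)"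
    by simp
  have "c ` {..<n} \<subseteq> {..<q}"
    using assms(3) by (auto simp: c_def)
  then obtain a where a: "a < q"
    and "real (card {..<n}) + norm (\<Sum>j<n. zeta q ^ c j) \<le> real q * real (card {j\<in>{..<n}. c j = a})"
    using dominant_residue_class[OF assms(3) finite_lessThan] by metis
  with S' have bound: "real n + sqrt (real n) \<le> real q * real (card {j\<in>{..<n}. c j = a})"
    by simp
  have "v \<in> log_rows q H"
    using i dim by (auto simp: v_def log_rows_def rows_def log_form_def)
  then have mem: "add_const q a v \<in> butson_code q H"
    using a by (auto simp: butson_code_def)
  have "v \<in> carrier_vec n"
    unfolding v_def by (rule carrier_vecI) (simp add: log_form_def dim)
  then have "hamming_dist x (add_const q a v) + card {j\<in>{..<n}. c j = a} = n"
    unfolding c_def by (rule hamming_dist_add_const[OF _ x v(1) a])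
  then have dist: "real (hamming_dist x (add_const q a v)) = real n - real (card {j\<in>{..<n}. c j = a})"
    by linarith
  \<comment> \<open>The distance is \<open>n\<close> minus the number of agreements, and
    \<open>q\<close> times that number is at least \<open>n + sqrt n\<close> by
    \<open>bound\<close>.\<close>
  have "real (hamming_dist x (add_const q a v)) * real q \<le> (real q - 1) * real n - sqrt (real n)"
    unfolding dist using bound by (simp add: algebra_simps)
  then have "real (hamming_dist x (add_const q a v)) \<le> ((real q - 1) * real n - sqrt (real n)) / real q"
    using assms(3) by (simp add: pos_le_divide_eq)
  also have "\<dots> = (real q - 1) / real q * real n - 1 / real q * sqrt (real n)"
    by (simp only: times_divide_eq_left mult_1 flip: diff_divide_distrib)
  finally have "real (hamming_dist x (add_const q a v))
      \<le> (real q - 1) / real q * real n - 1 / real q * sqrt (real n)" .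
  with mem show ?thesis
    by blast
qed

theorem theorem5p3:
  fixes n q :: nat and H :: "complex mat"
  assumes "prime q" and "odd q"
    and "n \<ge> 1"
    and "H \<in> butson_hadamard n q"
  shows "real (covering_radius q n (butson_code q H))
    \<le> (real q - 1) / real q * real n - 1 / real q * sqrt (real n)"
proof (rule covering_radius_le)
  show "q > 0"
    using assms(1) by (rule prime_gt_0_nat)
qed (use butson_code_close_word[OF assms(4,3) prime_gt_1_nat[OF assms(1)]] finite_butson_code in blast)+

end
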